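(* The set $T_1$ of all almost unary functions $f:\mathbb{N}\times\mathbb{N}\to\mathbb{N}$ is a Borel subset of $\mathbb{N}^{\mathbb{N}^2}$.
   Context: A function $f:\mathbb{N}\times\mathbb{N}\to\mathbb{N}$ is almost unary if at least one of the following holds: there is $F:\mathbb{N}\to\mathbb{N}$ with $f(x,y)\le F(x)$ for all $x,y$; or there is $F:\mathbb{N}\to\mathbb{N}$ with $f(x,y)\le F(y)$ for all $x,y$. The space $\mathbb{N}^{\mathbb{N}^2}$ of all functions $\mathbb{N}^2\to\mathbb{N}$ carries the product topology, where $\mathbb{N}$ is discrete. *)

theory Defs
  imports "HOL-Analysis.Analysis"
begin

definition almost_unary :: "(nat \<times> nat \<Rightarrow> nat) \<Rightarrow> bool" where
  "almost_unary f \<longleftrightarrow>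
     (\<exists>F :: nat \<Rightarrow> nat. \<forall>x y. f (x, y) \<le> F x) \<or>
     (\<exists>F :: nat \<Rightarrow> nat. \<forall>x y. f (x, y) \<le> F y)"

definition T1 :: "(nat \<times> nat \<Rightarrow> nat) set" where
  "T1 = {f. almost_unary f}"

(* The topology on nat * nat => nat underlying "borel" is the type-class instance of
   HOL-Analysis.Function_Topology, i.e. the product topology of copies of nat. The open sets
   of nat come from its order topology, which is discrete (class discrete_topology). *)

end

theory Submission
  imports Defs
begin

text \<open>A bound \<open>F\<close> depending on one coordinate exists iff each section of
  \<open>f\<close> in that coordinate is bounded by some number. The quantifier over functions thus
  becomes quantifiers over numbers, and \<open>T1\<close> is a union of two sets built by countable
  unions and intersections from the closed sets \<open>{f. f p \<le> n}\<close>.\<close>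

text \<open>By choice, bounds for the single sections glue to one \<open>F\<close>.\<close>

lemma pointwise_bound_iff:
  fixes g :: "'a \<Rightarrow> 'b \<Rightarrow> 'c::ord"
  shows "(\<exists>F. \<forall>x y. g x y \<le> F x) \<longleftrightarrow> (\<forall>x. \<exists>n. \<forall>y. g x y \<le> n)"
  by metis

text \<open>Evaluation at \<open>p\<close> is continuous in the product topology, and closed rays
  are closed in an order topology.\<close>

lemma closed_coordinate_le:
  "closed {f :: 'a \<Rightarrow> 'b::linorder_topology. f p \<le> n}"
  by (intro closed_Collect_le continuous_on_product_coordinates continuous_on_const)

theorem mainTheorem3:
  shows "T1 \<in> sets (borel :: (nat \<times> nat \<Rightarrow> nat) measure)"
proof -
  have eq: "T1 = (\<Inter>x. \<Union>n. \<Inter>y. {f. f (x, y) \<le> n}) \<union> (\<Inter>y. \<Union>n. \<Inter>x. {f. f (x, y) \<le> n})"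
  proof (rule set_eqI)
    fix f :: "nat \<times> nat \<Rightarrow> nat"
    \<comment> \<open>The glueing lemma quantifies the argument of \<open>F\<close> first, so it is
      used with the arguments of \<open>f\<close> transposed and the quantifiers exchanged.\<close>
    have "(\<exists>F :: nat \<Rightarrow> nat. \<forall>x y. f (x, y) \<le> F y) \<longleftrightarrow> (\<forall>y. \<exists>n. \<forall>x. f (x, y) \<le> n)"
      using pointwise_bound_iff[of "\<lambda>y x. f (x, y)"] by (subst all_comm)
    then show "f \<in> T1 \<longleftrightarrow> f \<in> (\<Inter>x. \<Union>n. \<Inter>y. {f. f (x, y) \<le> n}) \<union> (\<Inter>y. \<Union>n. \<Inter>x. {f. f (x, y) \<le> n})"
      using pointwise_bound_iff[of "\<lambda>x y. f (x, y)"]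
      by (simp add: T1_def almost_unary_def)
  qed
  have "{f :: nat \<times> nat \<Rightarrow> nat. f p \<le> n} \<in> sets borel" for p n
    by (intro borel_closed closed_coordinate_le)
  then show ?thesis
    \<comment> \<open>All indices range over the countable type \<open>nat\<close>, so the
      operations stay inside the sigma-algebra.\<close>
    unfolding eq by (intro sets.Un sets.countable_INT'' sets.countable_UN'') auto
qed

end
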